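(* For every $k\ge2$, put $U_k=\mathcal A_k(E_k)$. Then $$U_k=\mathcal A_k(E_k^{\mathrm{ev+}})\sqcup\mathcal A_k(E_k^{\mathrm{odd0}})$$ (a disjoint union), where the first set consists only of odd offsets and the second only of even offsets. In particular, $$|U_k|=\left|\mathcal A_k(E_k^{\mathrm{ev+}})\right|+\left|\mathcal A_k(E_k^{\mathrm{odd0}})\right|.$$ Consequently, if both $\mathcal A_k(E_k^{\mathrm{ev+}})$ and $\mathcal A_k(E_k^{\mathrm{odd0}})$ have at most one element, then $|U_k|\le2$. Conversely, if at least one of these two image sets has more than one element, then either $|U_k|>2$, or else $U_k$ is a two-point set whose two elements have the same parity.
   Context: $\tau(n)$ is the number of positive divisors of $n$; $T(n)=n+\tau(n)$ on the positive integers, with iterates $T^s$. For $k\ge1$ the annular transfer map $\mathcal A_k:\{0,1,\dots,2k\}\to\{0,1,\dots,2k+2\}$ is defined as follows: for $0\le r\le 2k$, let $s\ge1$ be minimal with $T^s(k^2+r)\ge (k+1)^2$; then $\mathcal A_k(r)=T^s(k^2+r)-(k+1)^2$. For a set $A$ of offsets, $\mathcal A_k(A)=\{\mathcal A_k(r):r\in A\}$. For $k\ge2$ the exit set is $$E_k=\{\tau(k^2-j)-j:\ 1\le j\le 2k-2,\ \tau(k^2-j)\ge j\}\subseteq\{0,\dots,2k\}.$$ For a finite set $A$ of nonnegative integers, $A^{\mathrm{ev+}}$ is the set of positive even elements of $A$, and $A^{\mathrm{odd0}}$ is the set of elements of $A$ that are odd or equal to $0$. *)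

theory Defs
  imports Complex_Main
begin

definition divisor_tau :: "nat \<Rightarrow> nat" where
  "divisor_tau n = card {d. d dvd n}"

(* Only ever used at positive n; the value at 0 is irrelevant. *)
definition T :: "nat \<Rightarrow> nat" where
  "T n = n + divisor_tau n"

(* Total on nat; meant for k \<ge> 1 and offsets r \<le> 2 * k. The minimum exists by
   crossing_exists, so LEAST is genuine and the subtraction does not truncate. *)
definition annular_transfer :: "nat \<Rightarrow> nat \<Rightarrow> nat" where
  "annular_transfer k r =
     (let s = (LEAST s. 1 \<le> s \<and> (k + 1)^2 \<le> (T ^^ s) (k^2 + r))
      in (T ^^ s) (k^2 + r) - (k + 1)^2)"

(* Meant for k \<ge> 2, where j < k^2; both subtractions on nat are then exact. *)
definition exit_set :: "nat \<Rightarrow> nat set" where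
  "exit_set k = {divisor_tau (k^2 - j) - j | j.
     1 \<le> j \<and> j \<le> 2 * k - 2 \<and> j \<le> divisor_tau (k^2 - j)}"

definition ev_pos :: "nat set \<Rightarrow> nat set" where
  "ev_pos A = {a \<in> A. even a \<and> 0 < a}"

definition odd_zero :: "nat set \<Rightarrow> nat set" where
  "odd_zero A = {a \<in> A. odd a \<or> a = 0}"

lemma finite_exit_set: "finite (exit_set k)"
proof -
  have "exit_set k \<subseteq> (\<lambda>j. divisor_tau (k^2 - j) - j) ` {..2 * k}"
    by (auto simp: exit_set_def)
  then show ?thesis
    by (rule finite_subset) simp
qed

lemma divisor_tau_pos: "0 < n \<Longrightarrow> 0 < divisor_tau n"
  by (auto simp: divisor_tau_def card_gt_0_iff)

lemma T_iterate_ge: "0 < n \<Longrightarrow> n + s \<le> (T ^^ s) n"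
proof (induction s)
  case (Suc s)
  then show ?case
    using divisor_tau_pos[of "(T ^^ s) n"] T_def[of "(T ^^ s) n"] by simp
qed simp

lemma crossing_exists:
  assumes "1 \<le> k"
  shows "\<exists>s\<ge>1. (k + 1)^2 \<le> (T ^^ s) (k^2 + r)"
proof (intro exI conjI)
  show "(k + 1)^2 \<le> (T ^^ ((k + 1)^2)) (k^2 + r)"
    using T_iterate_ge[of "k^2 + r" "(k + 1)^2"] assms by simp
qed simp

lemma divisor_tau_less:
  assumes "0 < n" "n < m^2"
  shows "divisor_tau n < 2 * m"
proof -
  let ?S = "{d. d dvd n \<and> d < m}"
  have sub: "{d. d dvd n} \<subseteq> ?S \<union> (\<lambda>d. n div d) ` ?S"
  proof
    fix d assume "d \<in> {d. d dvd n}"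
    then obtain e where e: "n = d * e" by (auto simp: dvd_def)
    show "d \<in> ?S \<union> (\<lambda>d. n div d) ` ?S"
    proof (cases "d < m")
      case False
      have "e < m"
      proof (rule ccontr)
        assume "\<not> e < m"
        then have "m * m \<le> d * e" using False by (intro mult_le_mono) auto
        then show False using assms e by (simp add: power2_eq_square)
      qed
      moreover have "d = n div e" using e assms by simp
      moreover have "e dvd n" using e by simp
      ultimately show ?thesis by blast
    qed (use e in simp)
  qed
  have "0 < m" using assms by (cases m) auto
  have "?S \<subseteq> {1..<m}" using assms by (auto simp: Suc_le_eq dvd_pos_nat)
  then have S: "finite ?S" "card ?S \<le> m - 1"
    using finite_subset card_mono[of "{1..<m}" ?S] by auto
  have "divisor_tau n \<le> card (?S \<union> (\<lambda>d. n div d) ` ?S)"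
    unfolding divisor_tau_def using sub S by (intro card_mono) auto
  also have "\<dots> \<le> card ?S + card ?S"
    using card_Un_le[of ?S "(\<lambda>d. n div d) ` ?S"] card_image_le[OF S(1), of "\<lambda>d. n div d"]
    by linarith
  finally show ?thesis using S \<open>0 < m\<close> by linarith
qed

lemma exit_set_subset:
  assumes "2 \<le> k"
  shows "exit_set k \<subseteq> {0..2 * k}"
proof
  fix x assume "x \<in> exit_set k"
  then obtain j where j: "x = divisor_tau (k^2 - j) - j" "1 \<le> j" "j \<le> 2 * k - 2"
    by (auto simp: exit_set_def)
  obtain i where "k = i + 2" using assms le_Suc_ex by (metis add.commute)
  then have "j < k^2" using j by (simp add: power2_eq_square)
  then have "divisor_tau (k^2 - j) < 2 * k"
    using j by (intro divisor_tau_less) auto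
  then show "x \<in> {0..2 * k}" using j by auto
qed

lemma annular_transfer_le:
  assumes "1 \<le> k" "r \<le> 2 * k"
  shows "annular_transfer k r \<le> 2 * k + 2"
proof -
  define P where "P s \<longleftrightarrow> 1 \<le> s \<and> (k + 1)^2 \<le> (T ^^ s) (k^2 + r)" for s
  define s where "s = (LEAST s. P s)"
  have "P s" unfolding s_def using crossing_exists[OF assms(1)] by (metis LeastI P_def)
  then obtain t where t: "s = Suc t" by (cases s) (auto simp: P_def)
  define n where "n = (T ^^ t) (k^2 + r)"
  have "\<not> P t" using not_less_Least[of t P] t by (simp add: s_def)
  then have less: "n < (k + 1)^2"
    using assms by (cases "t = 0") (auto simp: P_def n_def power2_eq_square)
  have "0 < k^2 + r" using assms by simp
  then have "0 < n" using T_iterate_ge[of "k^2 + r" t] by (simp add: n_def del: add_gr_0)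
  then have "divisor_tau n < 2 * (k + 1)" using less by (rule divisor_tau_less)
  moreover have "annular_transfer k r = T n - (k + 1)^2"
    by (simp add: annular_transfer_def Let_def P_def[symmetric] s_def[symmetric] t n_def
        del: One_nat_def)
  ultimately show ?thesis using less by (simp add: T_def)
qed

end

theory Submission
  imports Defs
begin

text \<open>
  The number of divisors is odd exactly for squares. No square lies strictly between
  \<open>k\<^sup>2\<close> and \<open>(k + 1)\<^sup>2\<close>, so an orbit of \<^const>\<open>T\<close> that starts strictly inside this annulus
  keeps its parity up to and including the step that leaves it. As \<open>k\<^sup>2\<close> and \<open>(k + 1)\<^sup>2\<close> have
  opposite parities, the transfer map flips the parity of every positive offset. At offset
  \<open>0\<close> the first step adds the odd number \<open>\<tau>(k\<^sup>2)\<close>; this one extra change of parity makes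
  offset \<open>0\<close> behave like an odd offset. Hence positive even exit offsets have odd images,
  all other exit offsets have even images, and the two image sets are disjoint
  (\<open>odd_annular_transfer_iff\<close>). The counting claims follow from this.
\<close>

text \<open>
  The complementary divisor map \<open>d \<mapsto> n / d\<close> pairs the divisors below \<open>\<surd>n\<close> with those above
  it, so only a divisor equal to \<open>\<surd>n\<close> can make the count odd.
\<close>
lemma even_divisor_tau_iff:
  assumes "0 < n"
  shows "even (divisor_tau n) \<longleftrightarrow> (\<nexists>m. n = m^2)"
proof -
  let ?S = "{d. d dvd n \<and> d * d < n}"
  let ?L = "{d. d dvd n \<and> n < d * d}"
  let ?M = "{d. d * d = n}"
  have fin: "finite {d. d dvd n}"
    using assms by simp
  have finS: "finite ?S" and finL: "finite ?L" and finM: "finite ?M"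
    by (auto intro: finite_subset[OF _ fin])
  have swap: "n < (n div d) * (n div d) \<longleftrightarrow> d * d < n"
             "(n div d) * (n div d) < n \<longleftrightarrow> n < d * d"
             "n div d dvd n" "n div (n div d) = d" if "d dvd n" for d
  proof -
    obtain e where e: "n = d * e"
      using \<open>d dvd n\<close> by (rule dvdE)
    then have "0 < d" "0 < e" "n div d = e" "n div e = d"
      using assms by auto
    then show "n < (n div d) * (n div d) \<longleftrightarrow> d * d < n"
              "(n div d) * (n div d) < n \<longleftrightarrow> n < d * d"
              "n div d dvd n" "n div (n div d) = d"
      by (simp_all add: e)
  qed
  have "bij_betw (\<lambda>d. n div d) ?S ?L"
    by (rule bij_betw_byWitness[where f' = "\<lambda>d. n div d"]) (auto simp: swap)
  then have same: "card ?S = card ?L"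
    by (rule bij_betw_same_card)
  have split: "{d. d dvd n} = (?S \<union> ?L) \<union> ?M"
    by auto
  have sum: "card ((?S \<union> ?L) \<union> ?M) = (card ?S + card ?L) + card ?M"
    using finS finL finM by (subst card_Un_disjoint; (subst card_Un_disjoint)?) auto
  have "divisor_tau n = 2 * card ?S + card ?M"
    unfolding divisor_tau_def split sum same by simp
  moreover have "card ?M = (if \<exists>m. n = m^2 then 1 else 0)"
  proof (cases "\<exists>m. n = m^2")
    case True
    then obtain m where "n = m^2" by blast
    then have "?M = {m}"
      by (auto simp: power2_eq_square[symmetric])
    then show ?thesis using True by simp
  next
    case False
    then have "?M = {}" by (auto simp: power2_eq_square)
    then show ?thesis using False by simp
  qed
  ultimately show ?thesis by simp
qed

lemma not_square_between:
  fixes n k :: nat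
  assumes "k^2 < n" "n < (k + 1)^2"
  shows "\<nexists>m. n = m^2"
proof
  assume "\<exists>m. n = m^2"
  then obtain m where "n = m^2" by blast
  then have "k < m" "m < k + 1"
    using assms power_less_imp_less_base[of k 2 m] power_less_imp_less_base[of m 2 "k + 1"]
    by auto
  then show False by simp
qed

lemma even_T_iterate_iff:
  assumes "k^2 < n" "\<And>i. i < s \<Longrightarrow> (T ^^ i) n < (k + 1)^2"
  shows "even ((T ^^ s) n) \<longleftrightarrow> even n"
  using assms(2)
proof (induction s)
  case (Suc s)
  let ?m = "(T ^^ s) n"
  have "n + s \<le> ?m"
    using assms(1) by (intro T_iterate_ge) simp
  then have "k^2 < ?m"
    using assms(1) by linarith
  then have "even (divisor_tau ?m)"
    using Suc.prems[of s] not_square_between[of k ?m] even_divisor_tau_iff[of ?m] by auto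
  then show ?case
    using Suc by (simp add: T_def[of ?m])
qed simp

lemma annular_transfer_first_crossing:
  assumes "1 \<le> k" "r \<le> 2 * k"
  obtains t where
    "annular_transfer k r = (T ^^ Suc t) (k^2 + r) - (k + 1)^2"
    "(k + 1)^2 \<le> (T ^^ Suc t) (k^2 + r)"
    "\<And>i. i < Suc t \<Longrightarrow> (T ^^ i) (k^2 + r) < (k + 1)^2"
proof -
  define P where "P s \<longleftrightarrow> 1 \<le> s \<and> (k + 1)^2 \<le> (T ^^ s) (k^2 + r)" for s
  define s where "s = (LEAST s. P s)"
  have "P s"
    unfolding s_def using crossing_exists[OF assms(1)] by (metis LeastI P_def)
  moreover from this obtain t where t: "s = Suc t"
    by (cases s) (auto simp: P_def)
  moreover have "(T ^^ i) (k^2 + r) < (k + 1)^2" if "i < s" for i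
    \<comment> \<open>Minimality of \<open>s\<close> only concerns \<open>i \<ge> 1\<close>; for \<open>i = 0\<close> the bound is \<open>r \<le> 2 * k\<close>.\<close>
    using not_less_Least[of i P] that assms
    by (cases "i = 0") (auto simp: P_def s_def power2_eq_square)
  moreover have "annular_transfer k r = (T ^^ s) (k^2 + r) - (k + 1)^2"
    by (simp only: annular_transfer_def Let_def P_def s_def)
  ultimately show ?thesis
    using that[of t] by (auto simp only: P_def)
qed

text \<open>
  For \<open>r = 0\<close> the orbit starts on the square \<open>k\<^sup>2\<close>, where parity is not preserved. Its first
  step changes the parity and lands strictly above \<open>k\<^sup>2\<close>, after which parity is constant as
  for \<open>r > 0\<close>.
\<close>
lemma odd_annular_transfer_iff:
  assumes "1 \<le> k" "r \<le> 2 * k"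
  shows "odd (annular_transfer k r) \<longleftrightarrow> even r \<and> 0 < r"
proof -
  obtain t where t:
    "annular_transfer k r = (T ^^ Suc t) (k^2 + r) - (k + 1)^2"
    "(k + 1)^2 \<le> (T ^^ Suc t) (k^2 + r)"
    "\<And>i. i < Suc t \<Longrightarrow> (T ^^ i) (k^2 + r) < (k + 1)^2"
    using annular_transfer_first_crossing[OF assms] by blast
  have transfer: "odd (annular_transfer k r) \<longleftrightarrow> (even ((T ^^ Suc t) (k^2 + r)) \<longleftrightarrow> even k)"
    unfolding t(1) using t(2) by (auto simp del: funpow.simps)
  show ?thesis
  proof (cases "r = 0")
    case True
    have "odd (divisor_tau (k^2))"
      using even_divisor_tau_iff[of "k^2"] assms(1) by auto
    then have step: "k^2 < T (k^2)" "even (T (k^2)) \<longleftrightarrow> odd k"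
      using divisor_tau_pos[of "k^2"] assms(1) by (auto simp: T_def)
    have "even ((T ^^ t) (T (k^2))) \<longleftrightarrow> even (T (k^2))"
    proof (rule even_T_iterate_iff[OF step(1)])
      fix i assume "i < t"
      then show "(T ^^ i) (T (k^2)) < (k + 1)^2"
        using t(3)[of "Suc i"] True by (simp add: funpow_swap1)
    qed
    then have "even ((T ^^ Suc t) (k^2 + r)) \<longleftrightarrow> odd k"
      using step(2) True by (simp add: funpow_swap1)
    then show ?thesis
      using transfer True by simp
  next
    case False
    then have "even ((T ^^ Suc t) (k^2 + r)) \<longleftrightarrow> even (k^2 + r)"
      by (intro even_T_iterate_iff[of k] t(3)) auto
    then show ?thesis
      using transfer False by auto
  qed
qed

text \<open>
  If both parities occur and one of them occurs twice, there are at least three elements; so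
  a set of exactly two elements with a repeated parity consists of that parity alone.
\<close>
lemma card_gt_2_or_same_parity_pair:
  fixes X Y :: "nat set"
  assumes "finite X" "finite Y" "\<forall>x\<in>X. odd x" "\<forall>y\<in>Y. even y"
    and "card X > 1 \<or> card Y > 1"
  shows "card (X \<union> Y) > 2 \<or> (\<exists>a b. a \<noteq> b \<and> X \<union> Y = {a, b} \<and> (even a \<longleftrightarrow> even b))"
proof (cases "card (X \<union> Y) > 2")
  case False
  have "X \<inter> Y = {}"
    using assms(3,4) by blast
  then have "card (X \<union> Y) = card X + card Y"
    by (rule card_Un_disjoint[OF assms(1,2)])
  then consider "card X = 2" "card Y = 0" | "card X = 0" "card Y = 2"
    using False assms(5) by linarith
  then show ?thesis
  proof cases
    case 1
    then have "Y = {}" using assms(2) by simp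
    moreover obtain a b where "X = {a, b}" "a \<noteq> b"
      using 1 by (auto simp: card_2_iff)
    ultimately show ?thesis using assms(3) by auto
  next
    case 2
    then have "X = {}" using assms(1) by simp
    moreover obtain a b where "Y = {a, b}" "a \<noteq> b"
      using 2 by (auto simp: card_2_iff)
    ultimately show ?thesis using assms(4) by auto
  qed
qed simp

theorem proposition8p29:
  fixes k :: nat
  assumes "2 \<le> k"
  shows
    "let U = annular_transfer k ` exit_set k;
         X = annular_transfer k ` ev_pos (exit_set k);
         Y = annular_transfer k ` odd_zero (exit_set k)
     in U = X \<union> Y \<and> X \<inter> Y = {} \<and>
        (\<forall>x\<in>X. odd x) \<and> (\<forall>y\<in>Y. even y) \<and>
        card U = card X + card Y \<and>
        (card X \<le> 1 \<and> card Y \<le> 1 \<longrightarrow> card U \<le> 2) \<and>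
        (card X > 1 \<or> card Y > 1 \<longrightarrow>
           card U > 2 \<or> (\<exists>a b. a \<noteq> b \<and> U = {a, b} \<and> (even a \<longleftrightarrow> even b)))"
proof -
  define U where "U = annular_transfer k ` exit_set k"
  define X where "X = annular_transfer k ` ev_pos (exit_set k)"
  define Y where "Y = annular_transfer k ` odd_zero (exit_set k)"
  have "exit_set k = ev_pos (exit_set k) \<union> odd_zero (exit_set k)"
    by (auto simp: ev_pos_def odd_zero_def)
  then have U: "U = X \<union> Y"
    unfolding U_def X_def Y_def by (metis image_Un)
  have "finite U"
    by (simp add: U_def finite_exit_set)
  then have fin: "finite X" "finite Y"
    by (simp_all add: U)
  have parity: "odd (annular_transfer k r) \<longleftrightarrow> even r \<and> 0 < r" if "r \<in> exit_set k" for r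
    using that exit_set_subset[OF assms] assms by (intro odd_annular_transfer_iff) auto
  have X: "\<forall>x\<in>X. odd x"
    using parity by (auto simp: X_def ev_pos_def)
  have Y: "\<forall>y\<in>Y. even y"
    using parity by (auto simp: Y_def odd_zero_def)
  have disj: "X \<inter> Y = {}"
    using X Y by blast
  have card: "card U = card X + card Y"
    unfolding U using fin disj by (rule card_Un_disjoint)
  show ?thesis
    unfolding Let_def U_def[symmetric] X_def[symmetric] Y_def[symmetric]
    using U X Y disj card card_gt_2_or_same_parity_pair[OF fin X Y] by auto
qed

end
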